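(* Let $s\ge3$ be an integer and $\psi_s(z):=z^{s-1}(z+s)-(s-1)^{s-1}$. Every nontrivial root $\alpha$ of $\psi_s$ has degree as an algebraic number $$\deg\alpha>\delta(s):=\frac{(\log p_s)(s-1)}{1+\log(s-1)},$$ where $p_s$ is the least prime factor of $s-1$.
   Context: When $s$ is odd, $z=1-s$ is a (double) root of $\psi_s$, called trivial; all other roots are called nontrivial. When $s$ is even, all roots of $\psi_s$ are called nontrivial. *)

theory Defs
  imports Complex_Main "HOL-Computational_Algebra.Computational_Algebra"
begin

definition psi :: "nat \<Rightarrow> complex \<Rightarrow> complex" where
  "psi s z = z ^ (s - 1) * (z + of_nat s) - (of_nat (s - 1)) ^ (s - 1)"

definition nontrivial_root :: "nat \<Rightarrow> complex \<Rightarrow> bool" where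
  "nontrivial_root s z \<longleftrightarrow> psi s z = 0 \<and> \<not> (odd s \<and> z = 1 - of_nat s)"

definition alg_degree :: "complex \<Rightarrow> nat" where
  "alg_degree a = (LEAST n. \<exists>p :: rat poly. p \<noteq> 0 \<and> degree p = n \<and> poly (map_poly of_rat p) a = 0)"

definition least_prime_factor :: "nat \<Rightarrow> nat" where
  "least_prime_factor n = (LEAST p. prime p \<and> p dvd n)"

end

(* With n = s - 1, the number u = n / alpha is a root of the monic trinomial
   f = X^(n+1) - (n+1) X - n, hence an algebraic integer, and alpha is trivial iff u = -1.  Each
   root z of f satisfies |z|^n <= 2 n + 1 < e n.  As the norm N of u divides f(0) = - n, either
   |N| >= p_s, and then p_s^n <= |N|^n <= (2 n + 1)^d yields the bound on the degree d, or |N| = 1.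
   The latter is impossible.  For even n, every root of f other than -1 lies outside the unit disc.
   For odd n, f has exactly one negative root -b, which satisfies 1/4 < b^n < 1, while non-real
   roots have |z|^n >= 2 and come in conjugate pairs and the roots with non-negative real part have
   |z|^n >= 4; so no set of roots of f that is closed under conjugation has product of absolute
   value 1. *)

theory Submission
  imports Defs "HOL-Analysis.Complex_Transcendental"
begin

subsection \<open>The size of the roots of the trinomial\<close>

text \<open>Outside the unit disc the equation gives
  \<open>|u|^(n+1) <= (n+1) |u| + n <= (2n+1) |u|\<close>, and a factor \<open>|u|\<close> cancels.
  Inside the disc the bound is trivial.\<close>

lemma norm_power_le_of_root:
  fixes u :: complex
  assumes "u ^ Suc n = of_nat (Suc n) * u + of_nat n"
  shows "cmod u ^ n \<le> 2 * real n + 1"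
proof (cases "cmod u \<le> 1")
  case True
  then have "cmod u ^ n \<le> 1" by (simp add: power_le_one)
  then show ?thesis by simp
next
  case False
  have "cmod u ^ n * cmod u = cmod (of_nat (Suc n) * u + of_nat n)"
    by (metis assms norm_power power_Suc2)
  also have "\<dots> \<le> real (Suc n) * cmod u + real n"
    using norm_triangle_ineq[of "of_nat (Suc n) * u" "of_nat n"] by (simp add: norm_mult del: of_nat_Suc)
  also have "\<dots> \<le> real (Suc n) * cmod u + real n * cmod u"
    using False mult_left_mono[of 1 "cmod u" "real n"] by simp
  also have "\<dots> = (2 * real n + 1) * cmod u" by (simp add: algebra_simps)
  finally show ?thesis
    by (rule mult_right_le_imp_le) (use False in linarith)
qed

lemma norm_gt_1_of_root_even:
  fixes u :: complex
  assumes root: "u ^ Suc n = of_nat (Suc n) * u + of_nat n"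
    and "even n" "n > 0" "u \<noteq> - 1"
  shows "cmod u > 1"
proof (rule ccontr)
  assume "\<not> cmod u > 1"
  define x where "x = - u"
  have le: "cmod x \<le> 1"
    using \<open>\<not> cmod u > 1\<close> by (simp add: x_def)
  have "x \<noteq> 1"
    using \<open>u \<noteq> - 1\<close> by (metis x_def minus_minus)
  \<comment> \<open>Dividing by \<open>x - 1\<close> gives \<open>x + \<dots> + x ^ n = n\<close>, which forces \<open>x = 1\<close> in the unit disc.\<close>
  have "x ^ Suc n = of_nat (Suc n) * x - of_nat n"
    using root \<open>even n\<close> by (simp add: x_def algebra_simps)
  moreover have "(x - 1) * (\<Sum>i<n. x ^ Suc i) = x * ((x - 1) * (\<Sum>i<n. x ^ i))"
    by (simp add: sum_distrib_left mult.left_commute)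
  then have "(x - 1) * (\<Sum>i<n. x ^ Suc i) = x ^ Suc n - x"
    by (simp only: power_diff_1_eq[symmetric]) (simp add: algebra_simps)
  ultimately have "(x - 1) * (\<Sum>i<n. x ^ Suc i) = (x - 1) * of_nat n"
    by (simp only:) (simp add: algebra_simps)
  with \<open>x \<noteq> 1\<close> have "(\<Sum>i<n. x ^ Suc i) = of_nat n" by simp
  \<comment> \<open>The n real parts are at most 1 and sum to n, so each equals 1. Index 0 then
    gives \<open>Re x = 1\<close>, which together with \<open>|x| <= 1\<close> means
    \<open>x = 1\<close>.\<close>
  then have "(\<Sum>i<n. Re (x ^ Suc i)) = (\<Sum>i<n. 1)"
    by (metis Re_sum card_lessThan complex_Re_of_nat of_nat_sum sum_constant mult.right_neutral)
  moreover have "Re (x ^ Suc i) \<le> 1" for i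
    using complex_Re_le_cmod[of "x ^ Suc i"] power_le_one[OF norm_ge_zero le, of "Suc i"]
    by (simp only: norm_power)
  ultimately have "Re (x ^ Suc 0) = 1"
    using sum_mono_inv[of "\<lambda>i. Re (x ^ Suc i)" "{..<n}" "\<lambda>_. 1" 0] \<open>n > 0\<close> by auto
  then have "Re x = 1" by simp
  moreover have "Im x = 0"
    using le \<open>Re x = 1\<close> cmod_power2[of x] power_mono[OF le norm_ge_zero, of 2] by simp
  ultimately show False using \<open>x \<noteq> 1\<close> by (simp add: complex_eq_iff)
qed

text \<open>Sine increases up to \<open>pi / 2\<close>, so the worst case is
  \<open>t = pi / m\<close>, which is at most 4/5. There \<open>t - t^3/6 >= 4t/5\<close>, and
  \<open>4 pi / 5 > 2\<close>.\<close>

lemma mult_sin_ge_2: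
  assumes "m \<ge> 4" "pi / real m \<le> \<phi>" "\<phi> \<le> pi / 2"
  shows "real m * sin \<phi> \<ge> 2"
proof -
  define t where "t = pi / real m"
  have t: "0 < t" "t \<le> 4 / 5" and mt: "real m * t = pi"
    using assms(1) pi_approx by (auto simp: t_def field_simps)
  have "\<bar>sin t - t\<bar> \<le> t ^ 3 / 6"
    using Maclaurin_sin_bound[of t 3] t by (simp add: eval_nat_numeral sin_coeff_def lessThan_Suc)
  also have "\<dots> \<le> t * (4 / 5) ^ 2 / 6"
    using power_mono[OF t(2), of 2] t by (simp add: power3_eq_cube power2_eq_square mult.assoc)
  finally have "t * 4 / 5 \<le> sin t"
    using t(1) unfolding power2_eq_square by linarith
  then have "real m * (t * 4 / 5) \<le> real m * sin t"
    by (rule mult_left_mono) simp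
  moreover have "sin t \<le> sin \<phi>"
  proof (rule sin_monotone_2pi_le)
    show "- (pi / 2) \<le> t" using t(1) pi_gt_zero by linarith
  qed (use assms in \<open>simp_all add: t_def\<close>)
  ultimately show ?thesis
    using mt pi_approx mult_left_mono[of "sin t" "sin \<phi>" "real m"] by (simp add: mult.assoc[symmetric])
qed

text \<open>Dividing the equation by u gives \<open>u^n = (n+1) + n/u\<close>, and
  \<open>n/u\<close> has nonnegative real part along with u.\<close>

lemma norm_power_ge_4_of_root_Re_nonneg:
  fixes u :: complex
  assumes root: "u ^ Suc n = of_nat (Suc n) * u + of_nat n"
    and "n \<ge> 3" "Re u \<ge> 0"
  shows "cmod u ^ n \<ge> 4"
proof -
  have "u \<noteq> 0" using root \<open>n \<ge> 3\<close> by auto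
  have "u ^ n * u = (of_nat (Suc n) + of_nat n / u) * u"
    using root \<open>u \<noteq> 0\<close> by (simp add: field_simps)
  then have eq: "u ^ n = of_nat (Suc n) + of_nat n / u"
    using \<open>u \<noteq> 0\<close> by simp
  have "Re (of_nat n / u) \<ge> 0"
    using \<open>Re u \<ge> 0\<close> by (simp add: Re_divide)
  then have "4 \<le> Re (u ^ n)"
    unfolding eq using \<open>n \<ge> 3\<close> by simp
  also have "\<dots> \<le> cmod u ^ n"
    by (metis complex_Re_le_cmod norm_power)
  finally show ?thesis .
qed

text \<open>Conjugation and the stronger bound for \<open>Re u >= 0\<close> leave the open third
  quadrant. There \<open>- u\<close> has modulus r and argument \<phi> in (0, pi/2), and with
  \<open>m = n + 1\<close> the imaginary part of the equation reads
  \<open>r^n sin (m \<phi>) = - m sin \<phi>\<close>. Hence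
  \<open>r^n >= m sin \<phi> >= 2\<close>.\<close>

lemma norm_power_ge_2_of_root_odd:
  fixes u :: complex
  assumes root: "u ^ Suc n = of_nat (Suc n) * u + of_nat n"
    and "odd n" "n \<ge> 3" "Im u \<noteq> 0"
  shows "cmod u ^ n \<ge> 2"
proof -
  have *: "cmod u ^ n \<ge> 2"
    if root: "u ^ Suc n = of_nat (Suc n) * u + of_nat n" and "Re u < 0" "Im u < 0" for u :: complex
  proof -
    define m where "m = Suc n"
    define r \<phi> where "r = cmod (- u)" and "\<phi> = Arg (- u)"
    have "even m" "m \<ge> 4" using assms by (auto simp: m_def)
    have x: "- u = rcis r \<phi>" unfolding r_def \<phi>_def by (rule rcis_cmod_Arg[symmetric])
    have r: "r > 0" using that by (auto simp: r_def)
    have "r * cos \<phi> > 0" "r * sin \<phi> > 0"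
      using that x by (auto simp: complex_eq_iff)
    then have pos: "cos \<phi> > 0" "sin \<phi> > 0"
      using r by (simp_all add: zero_less_mult_iff)
    have "- pi < \<phi>" "\<phi> \<le> pi"
      using mpi_less_Arg[of "- u"] Arg_le_pi[of "- u"] by (simp_all add: \<phi>_def)
    have "\<phi> > 0"
      using \<open>- pi < \<phi>\<close> \<open>sin \<phi> > 0\<close> sin_ge_zero[of "- \<phi>"] by (rule_tac ccontr) auto
    have "\<phi> < pi / 2"
      using cos_monotone_0_pi_le[of "pi / 2" \<phi>] \<open>\<phi> \<le> pi\<close> pos by (rule_tac ccontr) auto
    \<comment> \<open>The imaginary part of the equation makes \<open>sin (m * \<phi>)\<close> negative, so \<open>\<phi>\<close> exceeds \<open>pi / m\<close>.\<close>
    have "(- u) ^ m + of_nat m * (- u) = of_nat n"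
      using root \<open>even m\<close> by (simp add: m_def)
    then have "Im (rcis r \<phi> ^ m + of_nat m * rcis r \<phi>) = 0"
      unfolding x by simp
    then have "r ^ m * sin (real m * \<phi>) + real m * (r * sin \<phi>) = 0"
      unfolding DeMoivre2 by simp
    moreover have "r ^ m = r * r ^ n" by (simp add: m_def)
    ultimately have "r * (r ^ n * sin (real m * \<phi>) + real m * sin \<phi>) = 0"
      by (simp only: distrib_left mult_ac)
    then have eq: "r ^ n * sin (real m * \<phi>) = - (real m * sin \<phi>)"
      using r by (simp add: add_eq_0_iff2)
    have "real m * \<phi> > pi"
    proof (rule ccontr)
      assume "\<not> real m * \<phi> > pi"
      then have "sin (real m * \<phi>) \<ge> 0"
        using \<open>\<phi> > 0\<close> by (intro sin_ge_zero) auto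
      then have "r ^ n * sin (real m * \<phi>) \<ge> 0" using r by simp
      moreover have "real m * sin \<phi> > 0" using pos \<open>m \<ge> 4\<close> by simp
      ultimately show False using eq by simp
    qed
    then have "2 \<le> real m * sin \<phi>"
      using \<open>\<phi> < pi / 2\<close> \<open>m \<ge> 4\<close> by (intro mult_sin_ge_2) (auto simp: field_simps)
    also have "\<dots> = r ^ n * - sin (real m * \<phi>)"
      using eq by simp
    also have "\<dots> \<le> r ^ n * 1"
      using r sin_ge_minus_one[of "real m * \<phi>"] by (intro mult_left_mono) auto
    finally show ?thesis by (simp add: r_def)
  qed
  show ?thesis
  proof (cases "Re u \<ge> 0")
    case True
    then show ?thesis using norm_power_ge_4_of_root_Re_nonneg[OF root \<open>n \<ge> 3\<close>] by simp
  next
    case False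
    have "cnj (u ^ Suc n) = cnj (of_nat (Suc n) * u + of_nat n)"
      using root by simp
    then have "cnj u ^ Suc n = of_nat (Suc n) * cnj u + of_nat n"
      by simp
    then show ?thesis
      using *[OF root] *[of "cnj u"] False \<open>Im u \<noteq> 0\<close> by (cases "Im u < 0") auto
  qed
qed

text \<open>Since \<open>n + 1\<close> is even, substituting \<open>u = - b\<close> makes every term
  on the left of the real equation positive, which is what the size and uniqueness arguments for b
  rest on.\<close>

lemma negative_root_odd:
  fixes u :: complex
  assumes root: "u ^ Suc n = of_nat (Suc n) * u + of_nat n"
    and "odd n" and real: "Im u = 0" "Re u < 0"
  obtains b where "u = - of_real b" "b > 0" "b ^ Suc n + real (Suc n) * b = real n"
proof -
  have u: "u = - of_real (- Re u)" using real by (simp add: complex_eq_iff)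
  have "of_real ((- Re u) ^ Suc n + real (Suc n) * (- Re u)) = (of_real (real n) :: complex)"
    using root \<open>odd n\<close> by (subst (asm) (1 2) u) simp
  then show ?thesis
    using real(2) u that[of "- Re u"] by (metis neg_0_less_iff_less of_real_eq_iff)
qed

text \<open>Write the equation as \<open>b (b^n + n + 1) = n\<close>. If \<open>b >= 1\<close>, the
  left side is at least \<open>n + 1\<close>. If \<open>b^n <= 1/4\<close>, then
  \<open>b >= 1 / (1 + 5/(4n))\<close>, so \<open>b^n >= exp (-5/4) > 1/4\<close>.\<close>

lemma small_root_bounds:
  fixes b :: real
  assumes "b > 0" and eq: "b ^ Suc n + real (Suc n) * b = real n" and "n > 0"
  shows "b < 1" "1 < 4 * b ^ n"
proof -
  have b: "b * (b ^ n + real (Suc n)) = real n"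
    using eq by (simp add: algebra_simps)
  show "b < 1"
  proof (rule ccontr)
    assume "\<not> b < 1"
    then have "1 * real (Suc n) \<le> b * (b ^ n + real (Suc n))"
      using assms by (intro mult_mono) auto
    then show False using b by simp
  qed
  show "1 < 4 * b ^ n"
  proof (rule ccontr)
    assume "\<not> 1 < 4 * b ^ n"
    then have "real n \<le> b * (1 / 4 + real (Suc n))"
      unfolding b[symmetric] using \<open>b > 0\<close> by (intro mult_left_mono) auto
    then have "1 \<le> b * (1 + 5 / (4 * real n))"
      using \<open>n > 0\<close> by (simp add: field_simps)
    also have "\<dots> \<le> b * exp (5 / (4 * real n))"
      using \<open>b > 0\<close> by (intro mult_left_mono exp_ge_add_one_self) auto
    finally have "1 ^ n \<le> (b * exp (5 / (4 * real n))) ^ n"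
      by (intro power_mono) auto
    also have "\<dots> = b ^ n * exp (5 / 4)"
      using \<open>n > 0\<close> by (simp add: power_mult_distrib exp_of_nat_mult[symmetric])
    \<comment> \<open>Taking fourth powers reduces this to \<open>e <= 3\<close>, because
      \<open>3^5 = 243 < 256 = 4^4\<close>.\<close>
    also have "exp (5 / 4) < (4 :: real)"
    proof -
      have "exp (5 / 4) ^ 4 = (exp 1 ^ 5 :: real)"
        by (simp add: exp_of_nat_mult[symmetric])
      also have "\<dots> \<le> 3 ^ 5" by (intro power_mono exp_le) auto
      also have "\<dots> < 4 ^ 4" by simp
      finally show ?thesis by (rule power_less_imp_less_base) simp
    qed
    finally show False
      using \<open>\<not> 1 < 4 * b ^ n\<close> \<open>b > 0\<close> by (simp add: mult.commute)
  qed
qed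

text \<open>The left side of the equation is strictly increasing on the positive reals.\<close>

lemma small_root_unique:
  fixes a b :: real
  assumes "a > 0" "b > 0" "a ^ Suc n + real (Suc n) * a = real n" "b ^ Suc n + real (Suc n) * b = real n"
  shows "a = b"
proof -
  have "\<not> x < y"
    if "x > 0" "x ^ Suc n + real (Suc n) * x = y ^ Suc n + real (Suc n) * y" for x y :: real
  proof
    assume "x < y"
    then have "x ^ Suc n + real (Suc n) * x < y ^ Suc n + real (Suc n) * y"
      using \<open>x > 0\<close> by (intro add_strict_mono power_strict_mono mult_strict_left_mono) auto
    then show False using that(2) by simp
  qed
  then show ?thesis using assms by (metis linorder_neqE)
qed

section \<open>Products of absolute values over conjugation-closed sets of roots\<close>

lemma prod_ge_of_subset:
  fixes f :: "'a \<Rightarrow> real"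
  assumes "finite A" "B \<subseteq> A" "\<And>x. x \<in> B \<Longrightarrow> f x \<ge> 0" "\<And>x. x \<in> A - B \<Longrightarrow> f x \<ge> 1"
  shows "prod f B \<le> prod f A"
proof -
  have "prod f B * 1 \<le> prod f B * prod f (A - B)"
    using assms by (intro mult_left_mono prod_ge_1 prod_nonneg) auto
  then show ?thesis using prod.subset_diff[OF assms(2,1), of f] by (simp add: mult.commute)
qed

text \<open>For even n all factors exceed 1. For odd n the n-th powers \<open>N z\<close> are
  compared: only the negative root v can have \<open>N v < 1\<close>. If v is alone, the product is
  below 1; any further root brings a factor of at least 4, which outweighs
  \<open>N v > 1/4\<close>.\<close>

lemma prod_norm_roots_neq_1:
  fixes Z :: "complex set"
  assumes "finite Z" "Z \<noteq> {}" and n: "n \<ge> 2"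
    and root: "\<And>z. z \<in> Z \<Longrightarrow> z ^ Suc n = of_nat (Suc n) * z + of_nat n"
    and cnj: "\<And>z. z \<in> Z \<Longrightarrow> cnj z \<in> Z"
    and "- 1 \<notin> Z"
  shows "(\<Prod>z\<in>Z. cmod z) \<noteq> 1"
proof (cases "even n")
  case True
  have "(\<Prod>z\<in>Z. cmod z) > 1"
    using norm_gt_1_of_root_even[OF root True] assms
    by (intro less_1_prod) auto
  then show ?thesis by simp
next
  case False
  then have "n \<ge> 3" using n by (cases "n = 2") auto
  note \<open>odd n\<close>
  define N where "N = (\<lambda>z :: complex. cmod z ^ n)"
  have N_prod: "(\<Prod>z\<in>Z. N z) = (\<Prod>z\<in>Z. cmod z) ^ n"
    by (simp add: N_def prod_power_distrib)
  have ge: "N z \<ge> 2" if "z \<in> Z" "\<not> (Im z = 0 \<and> Re z < 0)" for z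
    using norm_power_ge_2_of_root_odd[OF root[OF that(1)] \<open>odd n\<close> \<open>n \<ge> 3\<close>]
      norm_power_ge_4_of_root_Re_nonneg[OF root[OF that(1)] \<open>n \<ge> 3\<close>] that(2)
    by (cases "Im z = 0") (auto simp: N_def)
  show ?thesis
  proof (cases "\<exists>z\<in>Z. Im z = 0 \<and> Re z < 0")
    case False
    then have "(\<Prod>z\<in>Z. N z) > 1"
      using ge assms(1,2) by (intro less_1_prod) force+
    then show ?thesis using N_prod by auto
  next
    case True
    then obtain v where "v \<in> Z" "Im v = 0" "Re v < 0" by auto
    from negative_root_odd[OF root[OF \<open>v \<in> Z\<close>] \<open>odd n\<close> this(2,3)]
    obtain b where b: "v = - of_real b" "b > 0" "b ^ Suc n + real (Suc n) * b = real n" .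
    have b1: "b < 1" "1 < 4 * b ^ n"
      using small_root_bounds[OF b(2,3)] n by auto
    have Nv: "N v = b ^ n" using b by (simp add: N_def)
    have ge': "N z \<ge> 2" if "z \<in> Z - {v}" for z
    proof (rule ge)
      show "\<not> (Im z = 0 \<and> Re z < 0)"
      proof
        assume "Im z = 0 \<and> Re z < 0"
        then obtain c where "z = - of_real c" "c > 0" "c ^ Suc n + real (Suc n) * c = real n"
          using negative_root_odd[OF root \<open>odd n\<close>, of z] \<open>z \<in> Z - {v}\<close> by blast
        then show False
          using small_root_unique[of b c n] b \<open>z \<in> Z - {v}\<close> by auto
      qed
    qed (use that in auto)
    have "N v * (\<Prod>z\<in>Z - {v}. N z) \<noteq> 1"
    proof (cases "Z - {v} = {}")
      case True
      have "b ^ n < 1" using b b1 n by (intro power_less_one_iff[THEN iffD2]) auto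
      then show ?thesis unfolding True Nv by simp
    next
      case False
      then obtain u where u: "u \<in> Z - {v}" by auto
      \<comment> \<open>A real u is nonnegative by uniqueness of the negative root and contributes 4
        by itself. A non-real u contributes 2 * 2 together with its conjugate.\<close>
      have "4 \<le> (\<Prod>z\<in>Z - {v}. N z)"
      proof (cases "Im u = 0")
        case True
        then have "Re u \<ge> 0"
          using u negative_root_odd[OF root \<open>odd n\<close>, of u] small_root_unique[of b _ n] b
          by (metis DiffE linorder_not_less singleton_iff)
        then have "4 \<le> (\<Prod>z\<in>{u}. N z)"
          using norm_power_ge_4_of_root_Re_nonneg[OF root \<open>n \<ge> 3\<close>, of u] u by (simp add: N_def)
        also have "\<dots> \<le> (\<Prod>z\<in>Z - {v}. N z)"
          using ge' u assms(1) by (intro prod_ge_of_subset) force+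
        finally show ?thesis .
      next
        case False
        then have "u \<noteq> cnj u" by (auto simp: complex_eq_iff)
        have "cnj u \<in> Z - {v}" using u cnj[of u] False \<open>Im v = 0\<close> by auto
        have "2 * 2 \<le> N u * N (cnj u)"
          using ge' u \<open>cnj u \<in> Z - {v}\<close> by (intro mult_mono) force+
        also have "\<dots> = (\<Prod>z\<in>{u, cnj u}. N z)"
          using \<open>u \<noteq> cnj u\<close> by simp
        also have "\<dots> \<le> (\<Prod>z\<in>Z - {v}. N z)"
          using ge' u \<open>cnj u \<in> Z - {v}\<close> assms(1) by (intro prod_ge_of_subset) force+
        finally show ?thesis by simp
      qed
      then have "N v * 4 \<le> N v * (\<Prod>z\<in>Z - {v}. N z)"
        using Nv b by (intro mult_left_mono) auto
      moreover have "1 < N v * 4" using Nv b1 by simp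
      ultimately show ?thesis by linarith
    qed
    then have "(\<Prod>z\<in>Z. N z) \<noteq> 1"
      using prod.remove[OF assms(1) \<open>v \<in> Z\<close>, of N] by simp
    then show ?thesis using N_prod by auto
  qed
qed

subsection \<open>Integer polynomials vanishing at a complex number\<close>

lemma of_int_poly_add:
  "map_poly of_int (p + q) = (map_poly of_int p + map_poly of_int q :: 'a :: comm_ring_1 poly)"
  by (rule poly_eqI) (simp add: coeff_map_poly)

lemma of_int_poly_mult:
  "map_poly of_int (p * q) = (map_poly of_int p * map_poly of_int q :: 'a :: comm_ring_1 poly)"
  by (rule poly_eqI) (simp add: coeff_map_poly coeff_mult)

lemma of_int_poly_sum:
  "map_poly of_int (sum f A) = (\<Sum>i\<in>A. map_poly of_int (f i) :: 'a :: comm_ring_1 poly)"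
  by (induction A rule: infinite_finite_induct) (simp_all add: of_int_poly_add)

lemma degree_of_int_poly:
  "degree (map_poly of_int p :: 'a :: ring_char_0 poly) = degree p"
  by (rule degree_map_poly) simp

text \<open>Induction on the coefficients: prepending \<open>a = k / l\<close> multiplies the common
  denominator c of the others by l.\<close>

lemma clear_denominators:
  fixes p :: "rat poly"
  obtains c :: int and q :: "int poly"
  where "c \<noteq> 0" "map_poly of_int q = smult (of_int c) p"
proof (induction p arbitrary: thesis)
  case 0
  show ?case by (rule 0[of 1 0]) auto
next
  case (pCons a p)
  obtain c q where cq: "c \<noteq> 0" "map_poly of_int q = smult (of_int c) p"
    by (rule pCons.IH)
  obtain k l where kl: "quotient_of a = (k, l)" by force
  then have "l > 0" "a = of_int k / of_int l"
    by (simp_all add: quotient_of_denom_pos quotient_of_div)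
  then have "map_poly of_int (pCons (c * k) (smult l q)) = smult (of_int (l * c)) (pCons a p)"
    using cq(2) by (simp add: map_poly_pCons map_poly_smult)
  then show ?case
    using \<open>l > 0\<close> cq(1) by (intro pCons.prems[of "l * c"]) auto
qed

text \<open>The polynomial p shows that the minimum defining \<open>alg_degree\<close> is attained.
  Clearing denominators in a rational polynomial attaining it preserves the degree.\<close>

lemma int_poly_of_alg_degree:
  assumes "p \<noteq> 0" "poly (map_poly of_int p) a = 0"
  obtains q :: "int poly"
  where "q \<noteq> 0" "degree q = alg_degree a" "poly (map_poly of_int q) a = 0"
proof -
  have of_rat_of_int: "map_poly of_rat (map_poly of_int p :: rat poly) = (map_poly of_int p :: complex poly)" for p
    by (rule poly_eqI) (simp add: coeff_map_poly)
  have "\<exists>n. \<exists>r :: rat poly. r \<noteq> 0 \<and> degree r = n \<and> poly (map_poly of_rat r) a = 0"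
    using assms by (intro exI[of _ "map_poly of_int p"] exI)
      (auto simp: of_rat_of_int map_poly_eq_0_iff)
  then obtain r :: "rat poly"
    where r: "r \<noteq> 0" "degree r = alg_degree a" "poly (map_poly of_rat r) a = 0"
    unfolding alg_degree_def by (rule LeastI_ex[THEN exE]) blast
  obtain c q where cq: "c \<noteq> 0" "map_poly of_int q = smult (of_int c) r"
    by (rule clear_denominators)
  have "map_poly of_int q = smult (of_int c) (map_poly of_rat r :: complex poly)"
    unfolding of_rat_of_int[symmetric] cq(2)
    by (rule poly_eqI) (simp add: coeff_map_poly of_rat_mult)
  then show ?thesis
    using r cq degree_of_int_poly[of q, where 'a = rat] by (intro that[of q]) auto
qed

text \<open>The witness is the scaled reciprocal polynomial \<open>x^d q(k/x)\<close>, whose value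
  at \<open>k/a\<close> is \<open>(k/a)^d q(a)\<close>. Its constant coefficient is
  \<open>k^d\<close> times the leading coefficient of q, hence nonzero; its degree drops below d
  when \<open>q(0) = 0\<close>.\<close>

lemma int_poly_root_divide:
  fixes a :: complex and k :: nat
  assumes "q \<noteq> 0" "poly (map_poly of_int q) a = 0" "a \<noteq> 0" "k > 0"
  obtains q' :: "int poly"
  where "q' \<noteq> 0" "degree q' \<le> degree q" "poly (map_poly of_int q') (of_nat k / a) = 0"
proof -
  define d where "d = degree q"
  define q' where "q' = (\<Sum>i\<le>d. monom (coeff q i * int k ^ i) (d - i))"
  have "coeff q' 0 = (\<Sum>i\<le>d. if i = d then coeff q i * int k ^ i else 0)"
    unfolding q'_def coeff_sum by (rule sum.cong) (auto simp: coeff_monom)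
  then have "coeff q' 0 = coeff q d * int k ^ d" by simp
  then have "q' \<noteq> 0"
    using assms by (auto simp: d_def)
  moreover have "degree q' \<le> d"
    unfolding q'_def by (rule degree_sum_le) (auto intro: order_trans[OF degree_monom_le])
  moreover have "poly (map_poly of_int q') (of_nat k / a) = 0"
  proof -
    have "poly (map_poly of_int q') (of_nat k / a)
        = (\<Sum>i\<le>d. of_int (coeff q i) * of_nat k ^ i * (of_nat k / a) ^ (d - i))"
      unfolding q'_def of_int_poly_sum poly_sum
      by (intro sum.cong refl) (simp add: map_poly_monom poly_monom)
    also have "\<dots> = (\<Sum>i\<le>d. (of_nat k / a) ^ d * (of_int (coeff q i) * a ^ i))"
    proof (rule sum.cong)
      fix i assume "i \<in> {..d}"
      then have "(of_nat k / a) ^ d = (of_nat k / a) ^ i * (of_nat k / a) ^ (d - i)"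
        by (simp flip: power_add)
      then show "of_int (coeff q i) * of_nat k ^ i * (of_nat k / a) ^ (d - i)
          = (of_nat k / a) ^ d * (of_int (coeff q i) * a ^ i)"
        using \<open>a \<noteq> 0\<close> by (simp add: power_divide)
    qed simp
    also have "\<dots> = (of_nat k / a) ^ d * poly (map_poly of_int q) a"
      by (simp add: poly_altdef degree_of_int_poly coeff_map_poly sum_distrib_left d_def)
    finally show ?thesis using assms by simp
  qed
  ultimately show ?thesis using that d_def by blast
qed

section \<open>Minimal primitive integer polynomials\<close>

text \<open>This g replaces the minimal polynomial over the rationals. Passing to the primitive part
  keeps the degree and allows Gauss's lemma to be applied to g.\<close>

lemma primitive_minimal_int_poly:
  fixes u :: complex
  assumes "q \<noteq> 0" "poly (map_poly of_int q) u = 0"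
  obtains g :: "int poly"
  where "g \<noteq> 0" "content g = 1" "poly (map_poly of_int g) u = 0"
    "\<And>h. h \<noteq> 0 \<Longrightarrow> poly (map_poly of_int h) u = 0 \<Longrightarrow> degree g \<le> degree h"
proof -
  define P where "P = (\<lambda>h :: int poly. h \<noteq> 0 \<and> poly (map_poly of_int h) u = 0)"
  have "P q" using assms by (simp add: P_def)
  define h where "h = arg_min degree P"
  have h: "P h" "\<And>h'. P h' \<Longrightarrow> degree h \<le> degree h'"
    unfolding h_def using arg_min_nat_lemma[of P q degree] \<open>P q\<close> by auto
  define g where "g = primitive_part h"
  have "map_poly of_int h = smult (of_int (content h)) (map_poly of_int g :: complex poly)"
    unfolding g_def by (metis content_times_primitive_part map_poly_smult of_int_0 of_int_mult)
  then have "poly (map_poly of_int g) u = 0"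
    using h(1) by (auto simp: P_def)
  then show ?thesis
    using h by (intro that[of g]) (auto simp: P_def g_def)
qed

text \<open>Pseudo-division gives \<open>a f = g q + r\<close>, and minimality forces
  \<open>r = 0\<close>. By Gauss's lemma q has the same content as \<open>a f\<close>, so a divides
  q and can be cancelled.\<close>

lemma primitive_minimal_int_poly_dvd:
  fixes u :: complex and f g :: "int poly"
  assumes "g \<noteq> 0" "content g = 1" "poly (map_poly of_int g) u = 0"
    and min: "\<And>h. h \<noteq> 0 \<Longrightarrow> poly (map_poly of_int h) u = 0 \<Longrightarrow> degree g \<le> degree h"
    and "poly (map_poly of_int f) u = 0"
  shows "g dvd f"
proof -
  define r where "r = pseudo_mod f g"
  obtain a q where aq: "a \<noteq> 0" "smult a f = g * q + r"
    using pseudo_mod(1)[OF \<open>g \<noteq> 0\<close>, of f] by (auto simp: r_def)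
  have "poly (map_poly of_int (smult a f)) u = 0"
    using assms(5) by (simp add: map_poly_smult)
  then have "poly (map_poly of_int r) u = 0"
    using assms(3) by (simp add: aq(2) of_int_poly_add of_int_poly_mult)
  then have "r = 0"
    using pseudo_mod(2)[OF \<open>g \<noteq> 0\<close>, of f] min[of r] unfolding r_def
    by (metis linorder_not_le)
  then have "content (smult a f) = content q"
    using aq(2) \<open>content g = 1\<close> by (simp add: content_mult)
  then have "a dvd content q"
    by (metis content_smult dvd_mult2 dvd_normalize_iff dvd_refl normalize_idem)
  then have "[:a:] dvd q"
    by (simp add: const_poly_dvd_iff_dvd_content)
  then obtain q' where "q = smult a q'" by (auto elim: dvdE)
  then have "smult a f = smult a (g * q')"
    using aq(2) \<open>r = 0\<close> by simp
  then show ?thesis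
    using \<open>a \<noteq> 0\<close> by (metis dvd_triv_left smult_cancel)
qed

subsection \<open>The degree bound\<close>

text \<open>For \<open>n >= 2\<close> one has \<open>2n + 1 <= 5n/2 < e n\<close>.\<close>

lemma ln_two_mult_plus_1_less:
  assumes "n \<ge> 2"
  shows "ln (2 * real n + 1) < 1 + ln (real n)"
proof -
  have "exp 1 > (5 / 2 :: real)"
    using abs_le_D2[OF e_approx_32] by simp
  then have "5 / 2 * real n < exp 1 * real n"
    using assms by (intro mult_strict_right_mono) auto
  moreover have "2 * real n + 1 \<le> 5 / 2 * real n"
    using assms by simp
  ultimately have "2 * real n + 1 < exp 1 * real n"
    by linarith
  then have "ln (2 * real n + 1) < ln (exp 1 * real n)"
    using assms by (subst ln_less_cancel_iff) auto
  then show ?thesis using assms by (simp add: ln_mult)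
qed

lemma least_prime_factor_le:
  assumes "k dvd n" "k > 1"
  shows "least_prime_factor n \<le> k"
proof -
  obtain p where "prime p" "p dvd k"
    using prime_factor_nat[of k] assms by auto
  then have "least_prime_factor n \<le> p"
    unfolding least_prime_factor_def using assms by (intro Least_le) auto
  also have "p \<le> k" using \<open>p dvd k\<close> assms by (intro dvd_imp_le) auto
  finally show ?thesis .
qed

lemma prime_least_prime_factor:
  assumes "n > 1"
  shows "prime (least_prime_factor n)"
proof -
  have "\<exists>p. prime p \<and> p dvd n"
    using prime_factor_nat[of n] assms by auto
  then show ?thesis
    unfolding least_prime_factor_def by (rule LeastI2_ex) auto
qed

section \<open>Roots and factors of the trinomial\<close>

definition trinomial :: "nat \<Rightarrow> int poly" where
  "trinomial n = monom 1 (Suc n) - monom (int (Suc n)) 1 - [:int n:]"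

lemma of_int_trinomial:
  "map_poly of_int (trinomial n)
    = (monom 1 (Suc n) - monom (of_nat (Suc n)) 1 - [:of_nat n:] :: complex poly)"
  by (rule poly_eqI) (simp add: trinomial_def coeff_map_poly coeff_pCons split: nat.split)

lemma poly_trinomial:
  "poly (map_poly of_int (trinomial n)) z = z ^ Suc n - of_nat (Suc n) * z - (of_nat n :: complex)"
  by (simp add: of_int_trinomial poly_monom)

lemma poly_pderiv_trinomial:
  "poly (pderiv (map_poly of_int (trinomial n))) z = of_nat (Suc n) * (z ^ n - 1 :: complex)"
  by (simp add: of_int_trinomial poly_monom pderiv_diff pderiv_monom pderiv_pCons right_diff_distrib
      del: of_nat_Suc)

lemma lead_coeff_trinomial:
  assumes "n > 0"
  shows "lead_coeff (trinomial n) = 1"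
proof -
  have "coeff (trinomial n) (Suc n) = 1"
    using assms by (simp add: trinomial_def coeff_pCons)
  moreover have "degree (trinomial n) \<le> Suc n"
    using assms unfolding trinomial_def
    by (intro degree_diff_le order_trans[OF degree_monom_le]) auto
  ultimately show ?thesis
    by (metis le_antisym le_degree zero_neq_one)
qed

text \<open>The derivative is \<open>(n+1) (z^n - 1)\<close>, so \<open>z^n = 1\<close> expresses
  that z is a multiple root. The equation then becomes \<open>z = (n+1) z + n\<close>.\<close>

lemma multiple_root_trinomial:
  fixes z :: complex
  assumes "z ^ Suc n = of_nat (Suc n) * z + of_nat n" "z ^ n = 1" "n > 0"
  shows "z = - 1"
proof -
  have "of_nat n * (z + 1) = 0"
    using assms(1,2) by (simp add: algebra_simps)
  then show ?thesis using \<open>n > 0\<close> by (simp add: add_eq_0_iff2)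
qed

text \<open>Otherwise \<open>X - k\<close> could be split off from g, leaving a polynomial of
  smaller degree that still vanishes at u. With \<open>k = -1\<close> this keeps the trivial root
  away from the conjugates of u.\<close>

lemma minimal_int_poly_root_int:
  fixes u :: complex and g :: "int poly"
  assumes "g \<noteq> 0" "poly (map_poly of_int g) u = 0"
    and min: "\<And>h. h \<noteq> 0 \<Longrightarrow> poly (map_poly of_int h) u = 0 \<Longrightarrow> degree g \<le> degree h"
    and "poly (map_poly of_int g) (of_int k :: complex) = 0"
  shows "u = of_int k"
proof (rule ccontr)
  assume "u \<noteq> of_int k"
  have "of_int (poly g k) = poly (map_poly of_int g) (of_int k :: complex)"
    by (simp add: poly_altdef degree_of_int_poly coeff_map_poly)
  then have "poly g k = 0" using assms(4) by simp
  then obtain h where h: "g = [:- k, 1:] * h"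
    using poly_eq_0_iff_dvd by blast
  then have "h \<noteq> 0" using \<open>g \<noteq> 0\<close> by auto
  have "poly (map_poly of_int g) u = (u - of_int k) * poly (map_poly of_int h) u"
    unfolding h of_int_poly_mult by (simp add: map_poly_pCons left_diff_distrib)
  then have "poly (map_poly of_int h) u = 0"
    using assms(2) \<open>u \<noteq> of_int k\<close> by simp
  then have "degree g \<le> degree h" using min \<open>h \<noteq> 0\<close> by blast
  moreover have "degree g = Suc (degree h)"
    unfolding h using \<open>h \<noteq> 0\<close> by (subst degree_mult_eq) auto
  ultimately show False by simp
qed

text \<open>Vieta's formula: as all roots are simple, the product over roots with multiplicity is a
  product over the set of roots.\<close>

lemma norm_constant_coeff_rsquarefree:
  fixes p :: "complex poly"
  assumes "rsquarefree p" "cmod (lead_coeff p) = 1"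
  shows "cmod (coeff p 0) = (\<Prod>z | poly p z = 0. cmod z)"
    and "card {z. poly p z = 0} = degree p"
proof -
  define Z where "Z = {z. poly p z = 0}"
  have p: "p = smult (lead_coeff p) (\<Prod>z\<in>Z. [:- z, 1:])"
    unfolding Z_def by (rule complex_poly_decompose_rsquarefree[OF assms(1), symmetric])
  have "coeff p 0 = lead_coeff p * (\<Prod>z\<in>Z. - z)"
    unfolding poly_0_coeff_0[symmetric] by (subst p) (simp add: poly_prod)
  then show "cmod (coeff p 0) = (\<Prod>z | poly p z = 0. cmod z)"
    using assms(2) by (simp add: norm_mult Z_def flip: prod_norm)
  have "lead_coeff p \<noteq> 0" using assms(2) by auto
  then have "degree p = degree (\<Prod>z\<in>Z. [:- z, 1:])"
    using p by (metis degree_smult_eq)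
  also have "\<dots> = (\<Sum>z\<in>Z. degree [:- z, 1:])"
    by (rule degree_prod_sum_eq) auto
  finally show "card {z. poly p z = 0} = degree p"
    by (simp add: Z_def)
qed

text \<open>The roots of the minimal g are the conjugates of u. Their product has absolute value k,
  a divisor of n other than 1, so \<open>p^n <= k^n <= (2n+1)^(degree g)\<close> for the least prime
  factor p of n. Logarithms give the bound.\<close>

lemma degree_gt_of_trinomial_root:
  fixes u :: complex and q :: "int poly"
  assumes root: "u ^ Suc n = of_nat (Suc n) * u + of_nat n" and "u \<noteq> - 1" and n: "n \<ge> 2"
    and q: "q \<noteq> 0" "poly (map_poly of_int q) u = 0"
  shows "real (degree q) > ln (real (least_prime_factor n)) * real n / (1 + ln (real n))"
proof -
  obtain g where g: "g \<noteq> 0" "content g = 1" "poly (map_poly of_int g) u = 0"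
    and min: "\<And>h. h \<noteq> 0 \<Longrightarrow> poly (map_poly of_int h) u = 0 \<Longrightarrow> degree g \<le> degree h"
    using primitive_minimal_int_poly[OF q] by blast
  have "poly (map_poly of_int (trinomial n)) u = 0"
    using root by (simp add: poly_trinomial)
  then have "g dvd trinomial n"
    using primitive_minimal_int_poly_dvd[OF g] min by blast
  then obtain h where h: "trinomial n = g * h" by (rule dvdE)
  define G where "G = (map_poly of_int g :: complex poly)"
  define Z where "Z = {z. poly G z = 0}"
  have "G \<noteq> 0" using g(1) by (simp add: G_def map_poly_eq_0_iff)
  then have "finite Z" by (simp add: Z_def poly_roots_finite)
  have "u \<in> Z" using g(3) by (simp add: Z_def G_def)
  have F: "map_poly of_int (trinomial n) = G * map_poly of_int h"
    by (simp add: h of_int_poly_mult G_def)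
  have rootZ: "z ^ Suc n = of_nat (Suc n) * z + of_nat n" if "z \<in> Z" for z
    using that poly_trinomial[of n z] by (simp add: F Z_def diff_diff_eq)
  have "- 1 \<notin> Z"
    using minimal_int_poly_root_int[OF g(1,3) min, of "- 1"] \<open>u \<noteq> - 1\<close>
    by (auto simp: Z_def G_def)
  have "cnj z \<in> Z" if "z \<in> Z" for z
    using that real_poly_cnj_root_iff[of G z] by (simp add: Z_def G_def coeff_map_poly)
  then have neq_1: "(\<Prod>z\<in>Z. cmod z) \<noteq> 1"
    using \<open>finite Z\<close> \<open>u \<in> Z\<close> n rootZ \<open>- 1 \<notin> Z\<close> by (intro prod_norm_roots_neq_1) auto
  \<comment> \<open>A multiple root of g is one of the trinomial, hence equal to -1, which is not a
    root of g.\<close>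
  have "rsquarefree G"
    unfolding rsquarefree_roots
  proof (intro allI notI, elim conjE)
    fix z assume z: "poly G z = 0" "poly (pderiv G) z = 0"
    then have "poly (pderiv (G * map_poly of_int h)) z = 0"
      by (simp add: pderiv_mult)
    then have "of_nat (Suc n) * (z ^ n - 1) = 0"
      by (simp only: F[symmetric] poly_pderiv_trinomial)
    then have "z ^ n = 1" by (simp del: of_nat_Suc)
    then have "z = - 1"
      using multiple_root_trinomial[OF rootZ, of z] z n by (simp add: Z_def)
    then show False using z \<open>- 1 \<notin> Z\<close> by (simp add: Z_def)
  qed
  \<comment> \<open>The trinomial is monic, so its integer factor g has leading coefficient 1 or -1;
    in particular u is an algebraic integer.\<close>
  have "lead_coeff g * lead_coeff h = 1"
    using lead_coeff_trinomial[of n] n by (simp add: h lead_coeff_mult)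
  then have "\<bar>lead_coeff g\<bar> = 1"
    by (metis abs_zmult_eq_1 abs_1)
  then have "cmod (lead_coeff G) = 1"
    by (simp add: G_def degree_of_int_poly coeff_map_poly)
  note Z_prod = norm_constant_coeff_rsquarefree[OF \<open>rsquarefree G\<close> this, folded Z_def]
  \<comment> \<open>The absolute norm of \<^term>\<open>u\<close>.\<close>
  define k where "k = nat \<bar>coeff g 0\<bar>"
  have k: "real k = (\<Prod>z\<in>Z. cmod z)"
    using Z_prod(1) by (simp add: k_def G_def coeff_map_poly)
  have "coeff g 0 * coeff h 0 = coeff (trinomial n) 0"
    by (simp add: h coeff_mult_0)
  then have "coeff g 0 * coeff h 0 = - int n"
    by (simp add: trinomial_def)
  then have "coeff g 0 dvd int n"
    by (metis dvd_minus_iff dvd_triv_left)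
  then have "k dvd n"
    by (simp add: k_def nat_abs_dvd_iff)
  then have "k > 1"
    using k neq_1 n by (cases "k = 0"; cases "k = 1") auto
  have "card Z > 0" using \<open>u \<in> Z\<close> \<open>finite Z\<close> by (auto simp: card_gt_0_iff)
  then have deg: "real (degree g) > 0"
    using Z_prod(2) by (simp add: G_def degree_of_int_poly)
  define p where "p = least_prime_factor n"
  have "p \<le> k" "p > 1"
    using least_prime_factor_le[OF \<open>k dvd n\<close> \<open>k > 1\<close>]
      prime_gt_1_nat[OF prime_least_prime_factor[of n]] n by (auto simp: p_def)
  have "real k ^ n = (\<Prod>z\<in>Z. cmod z ^ n)"
    by (simp add: k prod_power_distrib)
  also have "\<dots> \<le> (\<Prod>z\<in>Z. 2 * real n + 1)"
    by (intro prod_mono conjI norm_power_le_of_root rootZ) auto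
  also have "\<dots> = (2 * real n + 1) ^ degree g"
    using Z_prod(2) by (simp add: G_def degree_of_int_poly)
  finally have "ln (real k ^ n) \<le> ln ((2 * real n + 1) ^ degree g)"
    using \<open>k > 1\<close> by (subst ln_le_cancel_iff) auto
  then have "real n * ln (real k) \<le> real (degree g) * ln (2 * real n + 1)"
    using \<open>k > 1\<close> by (simp add: ln_realpow)
  moreover have "real n * ln (real p) \<le> real n * ln (real k)"
    using \<open>p \<le> k\<close> \<open>p > 1\<close> by (intro mult_left_mono) auto
  \<comment> \<open>The strictness of the final bound comes from
    \<open>2n + 1 < e n\<close>.\<close>
  moreover have "real (degree g) * ln (2 * real n + 1) < real (degree g) * (1 + ln (real n))"
    using deg ln_two_mult_plus_1_less[OF n] by (rule mult_strict_left_mono[rotated])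
  moreover have "real (degree g) * (1 + ln (real n)) \<le> real (degree q) * (1 + ln (real n))"
    using min[OF q] n by (intro mult_right_mono) auto
  ultimately have "ln (real p) * real n < real (degree q) * (1 + ln (real n))"
    by (simp add: mult.commute)
  moreover have "1 + ln (real n) > 0" using n by (simp add: add_pos_nonneg)
  ultimately show ?thesis by (simp add: p_def divide_less_eq)
qed

theorem mainTheorem6:
  fixes s :: nat and \<alpha> :: complex
  assumes "s \<ge> 3" and "nontrivial_root s \<alpha>"
  shows "real (alg_degree \<alpha>) >
    ln (real (least_prime_factor (s - 1))) * (real s - 1) / (1 + ln (real s - 1))"
proof -
  define n where "n = s - 1"
  have n: "n \<ge> 2" "s = Suc n" using assms(1) by (auto simp: n_def)
  have eq: "\<alpha> ^ n * (\<alpha> + of_nat (Suc n)) = of_nat n ^ n"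
    using assms(2) by (simp add: nontrivial_root_def psi_def n)
  then have "\<alpha> \<noteq> 0" using n by (auto simp: zero_power)
  define u where "u = of_nat n / \<alpha>"
  have "u \<noteq> 0" using \<open>\<alpha> \<noteq> 0\<close> n by (simp add: u_def)
  have \<alpha>: "\<alpha> = of_nat n / u" using \<open>\<alpha> \<noteq> 0\<close> n by (simp add: u_def)
  have "(of_nat n / u) ^ n * (of_nat n / u + of_nat (Suc n)) = of_nat n ^ n"
    using eq unfolding \<alpha> .
  \<comment> \<open>Multiplication by \<open>u^(n+1)\<close> clears the denominators; the common
    factor \<open>n^n\<close> then cancels.\<close>
  then have "of_nat n ^ n * (of_nat n + of_nat (Suc n) * u) = of_nat n ^ n * u ^ Suc n"
    using \<open>u \<noteq> 0\<close> by (simp add: power_divide field_simps)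
  then have root: "u ^ Suc n = of_nat (Suc n) * u + of_nat n"
    using n by (simp add: add.commute)
  \<comment> \<open>For even n, \<open>u = -1\<close> means that \<alpha> is the trivial root
    \<open>1 - s\<close>. For odd n, -1 does not satisfy the equation for u.\<close>
  have "u \<noteq> - 1"
  proof
    assume "u = - 1"
    then have "odd n \<or> even n \<and> \<alpha> = 1 - of_nat s"
      using \<alpha> n by simp
    then have "odd n"
      using assms(2) n by (auto simp: nontrivial_root_def)
    then show False using root \<open>u = - 1\<close> by simp
  qed
  have "trinomial n \<noteq> 0" using lead_coeff_trinomial[of n] n by auto
  moreover have "poly (map_poly of_int (trinomial n)) u = 0"
    using root by (simp add: poly_trinomial)
  \<comment> \<open>The reciprocal construction is applied twice: here to show that \<alpha> is
    algebraic, and below to carry a polynomial of degree \<open>alg_degree \<alpha>\<close> from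
    \<alpha> back to u without raising the degree.\<close>
  ultimately obtain t where "t \<noteq> 0" "poly (map_poly of_int t) (of_nat n / u) = 0"
    using int_poly_root_divide[of "trinomial n" u n] \<open>u \<noteq> 0\<close> n by auto
  then obtain q where q: "q \<noteq> 0" "degree q = alg_degree \<alpha>" "poly (map_poly of_int q) \<alpha> = 0"
    using int_poly_of_alg_degree[of t \<alpha>] \<alpha> by auto
  then obtain q' where q': "q' \<noteq> 0" "degree q' \<le> degree q" "poly (map_poly of_int q') u = 0"
    using int_poly_root_divide[of q \<alpha> n] \<open>\<alpha> \<noteq> 0\<close> n unfolding u_def by auto
  have "ln (real (least_prime_factor n)) * real n / (1 + ln (real n)) < real (degree q')"
    using degree_gt_of_trinomial_root[OF root \<open>u \<noteq> - 1\<close> n(1) q'(1,3)] .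
  also have "\<dots> \<le> real (alg_degree \<alpha>)" using q'(2) q(2) by simp
  finally show ?thesis by (simp add: n)
qed

end
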